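(* Let $n$ and $k$ be integers with $1\le k\le n-1$, and let $G$ be a connected graph with $n$ vertices and vertex connectivity $\kappa(G)\le k$. Then $$SO(G)\geq 2\sqrt{2}(n-3)+2\sqrt{5},$$ with equality if and only if $G\cong P_{n}$.
   Context: All graphs are finite, simple and undirected. For a graph $G$ with edge set $E(G)$, $d(u)$ denotes the degree of vertex $u$, and the Sombor index is $SO(G)=\sum_{uv\in E(G)}\sqrt{d(u)^{2}+d(v)^{2}}$. $\kappa(G)$ is the usual vertex connectivity: the largest $k$ such that $G$ is $k$-connected, where $G$ is $k$-connected if $G\cong K_{k+1}$ (the complete graph on $k+1$ vertices), or $|V(G)|\ge k+2$ and $G$ cannot be disconnected by deleting fewer than $k$ vertices; thus $\kappa(K_n)=n-1$. $P_n$ denotes the path with $n$ vertices.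
   Formalization: The formal theorem assumes n ≥ 3. For n = 2, k = 1 the statement is false: the only such graph is K_2 = P_2, with SO = √2 ≈ 1.414, which is below the claimed bound 2√5 − 2√2 ≈ 1.644. *)

theory Defs
  imports Complex_Main "Graph_Theory.Graph_Theory"
begin

text \<open>A finite simple undirected graph is a \<^locale>\<open>pair_graph\<close>: every edge \<open>uv\<close> is represented by
  the two arcs \<open>(u,v)\<close> and \<open>(v,u)\<close>, so the degree of a vertex is its out-degree.\<close>

definition edge_set :: "'a pair_pre_digraph \<Rightarrow> 'a set set" where
  "edge_set G = {{u, v} | u v. (u, v) \<in> parcs G}"

abbreviation degree :: "'a pair_pre_digraph \<Rightarrow> 'a \<Rightarrow> nat" where
  "degree G u \<equiv> out_degree (with_proj G) u"

text \<open>As there are no loops, the inner sum over \<open>e = {u, v}\<close> is \<open>d(u)\<^sup>2 + d(v)\<^sup>2\<close>.\<close>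

definition sombor_index :: "'a pair_pre_digraph \<Rightarrow> real" where
  "sombor_index G = (\<Sum>e\<in>edge_set G. sqrt (\<Sum>u\<in>e. (real (degree G u))\<^sup>2))"

text \<open>The name of \<open>connected\<close> is qualified because of the topological predicate of the same name.\<close>

definition k_connected :: "nat \<Rightarrow> 'a pair_pre_digraph \<Rightarrow> bool" where
  "k_connected k G \<longleftrightarrow>
     complete_digraph (k + 1) (with_proj G) \<or>
     card (pverts G) \<ge> k + 2 \<and>
       (\<forall>S \<subseteq> pverts G. card S < k \<longrightarrow>
          Digraph_Component.connected (induce_subgraph (with_proj G) (pverts G - S)))"

text \<open>A nonempty graph is \<open>0\<close>-connected, and \<open>k\<close>-connectedness implies \<open>k + 1 \<le> |V(G)|\<close>;
  hence the maximum exists for every nonempty finite graph.\<close>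

definition vertex_connectivity :: "'a pair_pre_digraph \<Rightarrow> nat" where
  "vertex_connectivity G = (GREATEST k. k_connected k G)"

definition path_graph :: "nat \<Rightarrow> nat pair_pre_digraph" where
  "path_graph n = \<lparr> pverts = {..<n},
     parcs = {(i, j). i < n \<and> j < n \<and> (j = Suc i \<or> i = Suc j)} \<rparr>"

end

theory Submission
  imports Defs
begin

text \<open>Let \<open>c\<^sub>1 = 2\<surd>5 - 4\<surd>2\<close> and \<open>c\<^sub>2 = 6\<surd>2 - 2\<surd>5\<close>. For positive integers \<open>(a, b) \<noteq> (1, 1)\<close> we have
  \<open>\<surd>(a\<^sup>2 + b\<^sup>2) \<ge> c\<^sub>1 (1/a + 1/b) + c\<^sub>2\<close>, with equality exactly for \<open>a, b \<le> 2\<close>. In a connected graph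
  on \<open>n \<ge> 3\<close> vertices no edge joins two vertices of degree one, and summing \<open>1/d(u) + 1/d(v)\<close> over
  the edges gives \<open>n\<close>, so \<open>SO(G) \<ge> c\<^sub>1 n + c\<^sub>2 |E(G)| \<ge> c\<^sub>1 n + c\<^sub>2 (n - 1)\<close>, which is the bound. Equality
  forces \<open>n - 1\<close> edges and maximum degree at most two, that is, a path.\<close>

section \<open>A lower bound for the weight of an edge\<close>

lemma sqrt2_sqrt5_bounds:
  "7 / 5 < sqrt (2::real)" "sqrt (2::real) < 71 / 50" "11 / 5 < sqrt (5::real)" "sqrt (5::real) < 9 / 4"
  by (rule real_less_rsqrt real_less_lsqrt; simp add: power2_eq_square)+

text \<open>The coefficients make the bound tight at the pairs \<open>(1, 2)\<close> and \<open>(2, 2)\<close>, the edge types of a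
  path.\<close>

definition edge_bound :: "nat \<Rightarrow> nat \<Rightarrow> real" where
  "edge_bound a b = (2 * sqrt 5 - 4 * sqrt 2) * (1 / real a + 1 / real b) + (6 * sqrt 2 - 2 * sqrt 5)"

lemma edge_bound_commute: "edge_bound a b = edge_bound b a"
  by (simp add: edge_bound_def add.commute)

text \<open>The coefficient of the reciprocals is negative, so dropping \<open>1 / real b\<close>
  only raises the bound. What remains depends on \<open>a\<close> alone, while the weight grows with
  \<open>b\<close>.\<close>

lemma edge_bound_less_ordered:
  assumes "1 \<le> a" "a \<le> b" "3 \<le> b"
  shows "edge_bound a b < sqrt ((real a)\<^sup>2 + (real b)\<^sup>2)"
proof -
  note s = sqrt2_sqrt5_bounds
  have b: "(real b)\<^sup>2 \<ge> 3\<^sup>2" by (rule power_mono) (use assms in auto)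
  have neg: "2 * sqrt 5 - 4 * sqrt 2 < (0::real)" using s by linarith
  have le: "edge_bound a b \<le> (2 * sqrt 5 - 4 * sqrt 2) * (1 / real a) + (6 * sqrt 2 - 2 * sqrt 5)"
    unfolding edge_bound_def using neg by (simp add: mult_le_0_iff distrib_left divide_le_0_iff)
  consider "a = 1" | "a = 2" | "a \<ge> 3" using assms by linarith
  then show ?thesis
  proof cases
    case 1
    \<comment> \<open>The rationals \<open>79 / 25\<close>, \<open>18 / 5\<close> and
      \<open>21 / 5\<close> of the three cases lie just below sqrt 10, sqrt 13 and sqrt 18, the
      least possible weights. The bounds to beat are \<open>2 * sqrt 2\<close>,
      \<open>4 * sqrt 2 - sqrt 5\<close> and \<open>6 * sqrt 2 - 2 * sqrt 5\<close>, which are below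
      2.84, 3.48 and 4.12.\<close>
    have "79 / 25 \<le> sqrt ((real a)\<^sup>2 + (real b)\<^sup>2)"
      by (rule real_le_rsqrt) (use b 1 in \<open>simp add: power2_eq_square\<close>)
    with le 1 s show ?thesis by simp
  next
    case 2
    have "18 / 5 \<le> sqrt ((real a)\<^sup>2 + (real b)\<^sup>2)"
      by (rule real_le_rsqrt) (use b 2 in \<open>simp add: power2_eq_square\<close>)
    moreover have "edge_bound a b \<le> 4 * sqrt 2 - sqrt 5" using le 2 by (simp add: field_simps)
    ultimately show ?thesis using s by linarith
  next
    case 3
    have a: "(real a)\<^sup>2 \<ge> 3\<^sup>2" by (rule power_mono) (use 3 in auto)
    have "21 / 5 \<le> sqrt ((real a)\<^sup>2 + (real b)\<^sup>2)"
      by (rule real_le_rsqrt) (use b a in \<open>simp add: power2_eq_square\<close>)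
    moreover have "(2 * sqrt 5 - 4 * sqrt 2) * (1 / real a) \<le> 0"
      using neg by (simp add: divide_le_0_iff)
    ultimately show ?thesis using le s by linarith
  qed
qed

lemma edge_bound_less:
  assumes "1 \<le> a" "1 \<le> b" "3 \<le> a \<or> 3 \<le> b"
  shows "edge_bound a b < sqrt ((real a)\<^sup>2 + (real b)\<^sup>2)"
proof (cases "a \<le> b")
  case True
  then show ?thesis using assms by (intro edge_bound_less_ordered) auto
next
  case False
  then have "edge_bound b a < sqrt ((real b)\<^sup>2 + (real a)\<^sup>2)"
    using assms by (intro edge_bound_less_ordered) auto
  then show ?thesis by (simp add: edge_bound_commute add.commute)
qed

lemma edge_bound_eq:
  assumes "1 \<le> a" "1 \<le> b" "a \<le> 2" "b \<le> 2" "\<not> (a = 1 \<and> b = 1)"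
  shows "edge_bound a b = sqrt ((real a)\<^sup>2 + (real b)\<^sup>2)"
proof -
  have s8: "sqrt (8::real) = 2 * sqrt 2"
    using real_sqrt_mult[of 4 2] by simp
  have "(a = 1 \<and> b = 2) \<or> (a = 2 \<and> b = 1) \<or> (a = 2 \<and> b = 2)"
    using assms by auto
  then show ?thesis
    by (elim disjE) (simp_all add: edge_bound_def s8 field_simps)
qed

text \<open>The pair (1, 1) has to be excluded: there the bound is
  \<open>2 * sqrt 5 - 2 * sqrt 2\<close>, which exceeds the weight \<open>sqrt 2\<close>.\<close>

lemma edge_bound_le:
  assumes "1 \<le> a" "1 \<le> b" "\<not> (a = 1 \<and> b = 1)"
  shows "edge_bound a b \<le> sqrt ((real a)\<^sup>2 + (real b)\<^sup>2)"
proof (cases "3 \<le> a \<or> 3 \<le> b")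
  case True
  then show ?thesis using edge_bound_less assms by (simp add: less_imp_le)
next
  case False
  then show ?thesis using edge_bound_eq[of a b] assms by simp
qed

section \<open>Sums over arcs\<close>

context pair_graph
begin

lemma arc_rev: "(u, v) \<in> parcs G \<Longrightarrow> (v, u) \<in> parcs G"
  using pair_sym_arcs unfolding symmetric_def by (auto dest: symD)

lemma arc_neq: "(u, v) \<in> parcs G \<Longrightarrow> u \<noteq> v"
  using pair_no_loops by fastforce

text \<open>Grouping the arcs by their underlying edge gives fibres \<open>{(a, b), (b, a)}\<close>,
  of size two because there are no loops.\<close>

lemma sum_parcs_eq_sum_edge_set:
  fixes F :: "'a set \<Rightarrow> real"
  shows "(\<Sum>(u, v)\<in>parcs G. F {u, v}) = 2 * (\<Sum>e\<in>edge_set G. F e)"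
proof -
  have img: "edge_set G = (\<lambda>(u, v). {u, v}) ` parcs G"
    by (auto simp: edge_set_def)
  have fib: "(\<Sum>x\<in>{x \<in> parcs G. (case x of (u, v) \<Rightarrow> {u, v}) = e}. case x of (u, v) \<Rightarrow> F {u, v}) = 2 * F e"
    if e: "e \<in> edge_set G" for e
  proof -
    obtain a b where ab: "e = {a, b}" "(a, b) \<in> parcs G"
      using e by (auto simp: edge_set_def)
    have "{x \<in> parcs G. (case x of (u, v) \<Rightarrow> {u, v}) = e} = {(a, b), (b, a)}"
      using ab arc_rev by (auto simp: doubleton_eq_iff)
    moreover have "a \<noteq> b" using ab arc_neq by blast
    ultimately show ?thesis using ab by (simp add: insert_commute)
  qed
  have "(\<Sum>(u, v)\<in>parcs G. F {u, v}) =
    (\<Sum>e\<in>edge_set G. \<Sum>x\<in>{x \<in> parcs G. (case x of (u, v) \<Rightarrow> {u, v}) = e}. case x of (u, v) \<Rightarrow> F {u, v})"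
    using pair_finite_arcs by (intro sum.group[symmetric]) (auto simp: img)
  also have "\<dots> = 2 * (\<Sum>e\<in>edge_set G. F e)"
    using fib by (simp add: sum_distrib_left)
  finally show ?thesis .
qed

lemma sombor_index_parcs:
  "2 * sombor_index G = (\<Sum>(u, v)\<in>parcs G. sqrt ((real (degree G u))\<^sup>2 + (real (degree G v))\<^sup>2))"
  unfolding sombor_index_def sum_parcs_eq_sum_edge_set[symmetric]
  by (rule sum.cong) (auto dest: arc_neq)

text \<open>Group the arcs by their tail. Constant \<open>h\<close> gives the handshake identity,
  and \<open>h u = 1 / degree G u\<close> makes every vertex of positive degree count once.\<close>

lemma sum_parcs_fst:
  fixes h :: "'a \<Rightarrow> 'b :: comm_semiring_1"
  shows "(\<Sum>(u, v)\<in>parcs G. h u) = (\<Sum>u\<in>pverts G. of_nat (degree G u) * h u)"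
proof -
  have "(\<Sum>(u, v)\<in>parcs G. h u) = (\<Sum>w\<in>pverts G. \<Sum>x\<in>{x \<in> parcs G. fst x = w}. case x of (u, v) \<Rightarrow> h u)"
    using pair_finite_arcs pair_finite_verts
    by (intro sum.group[symmetric]) (auto dest: in_arcsD1)
  also have "\<dots> = (\<Sum>w\<in>pverts G. \<Sum>x\<in>{x \<in> parcs G. fst x = w}. h w)"
    by (intro sum.cong) (auto simp: case_prod_beta)
  finally show ?thesis by (simp add: out_degree_def out_arcs_def)
qed

lemma sum_parcs_snd:
  fixes h :: "'a \<Rightarrow> 'b :: comm_semiring_1"
  shows "(\<Sum>(u, v)\<in>parcs G. h v) = (\<Sum>(u, v)\<in>parcs G. h u)"
  by (rule sum.reindex_bij_witness[where i = prod.swap and j = prod.swap]) (auto intro: arc_rev)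

lemma card_parcs_eq_sum_degree: "card (parcs G) = (\<Sum>u\<in>pverts G. degree G u)"
  using sum_parcs_fst[of "\<lambda>_. 1::nat"] by simp

lemma sum_edge_bound:
  assumes "\<And>u. u \<in> pverts G \<Longrightarrow> 1 \<le> degree G u"
  shows "(\<Sum>(u, v)\<in>parcs G. edge_bound (degree G u) (degree G v)) =
    (2 * sqrt 5 - 4 * sqrt 2) * (2 * real (card (pverts G)))
    + (6 * sqrt 2 - 2 * sqrt 5) * real (card (parcs G))"
proof -
  let ?d = "\<lambda>u. real (degree G u)"
  have "(\<Sum>u\<in>pverts G. ?d u * (1 / ?d u)) = (\<Sum>u\<in>pverts G. 1)"
    using assms by (intro sum.cong) force+
  then have f: "(\<Sum>(u, v)\<in>parcs G. 1 / ?d u) = real (card (pverts G))"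
    using sum_parcs_fst[of "\<lambda>u. 1 / ?d u"] by simp
  then have g: "(\<Sum>(u, v)\<in>parcs G. 1 / ?d v) = real (card (pverts G))"
    using sum_parcs_snd[of "\<lambda>u. 1 / ?d u"] by simp
  have "(\<Sum>(u, v)\<in>parcs G. edge_bound (degree G u) (degree G v)) =
    (2 * sqrt 5 - 4 * sqrt 2) * ((\<Sum>(u, v)\<in>parcs G. 1 / ?d u) + (\<Sum>(u, v)\<in>parcs G. 1 / ?d v))
    + (\<Sum>(u, v)\<in>parcs G. 6 * sqrt 2 - 2 * sqrt 5)"
    unfolding edge_bound_def
    by (simp add: sum.distrib sum_distrib_left distrib_left case_prod_beta)
  then show ?thesis unfolding f g by simp
qed

section \<open>Connected graphs\<close>

text \<open>A walk from \<open>S\<close> to a vertex outside must cross the boundary somewhere.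
  Symmetry of the arcs provides a directed walk.\<close>

lemma connected_obtain_leaving_arc:
  assumes "Digraph_Component.connected (with_proj G)" "S \<subseteq> pverts G" "S \<noteq> {}" "S \<noteq> pverts G"
  obtains u v where "u \<in> S" "v \<in> pverts G - S" "(u, v) \<in> parcs G"
proof -
  obtain a b where ab: "a \<in> S" "b \<in> pverts G - S" using assms by blast
  have "strongly_connected (with_proj G)"
    using symmetric_connected_imp_strongly_connected[OF pair_sym_arcs] assms(1) by simp
  then have "a \<rightarrow>\<^sup>*\<^bsub>with_proj G\<^esub> b"
    using ab assms(2) by (auto simp: strongly_connected_def)
  then have "(a, b) \<in> (parcs G)\<^sup>*"
    using reachable_rtranclI by fastforce
  \<comment> \<open>Invariant along the walk: its current end is still in \<open>S\<close>, or a
    crossing arc has already been met.\<close>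
  then have "b \<in> S \<or> (\<exists>u\<in>S. \<exists>v. v \<notin> S \<and> (u, v) \<in> parcs G)"
    by (induction rule: rtrancl_induct) (use ab in auto)
  then show ?thesis using that ab in_arcsD2 by blast
qed

lemma connected_degree_pos:
  assumes "Digraph_Component.connected (with_proj G)" "card (pverts G) \<ge> 2" "u \<in> pverts G"
  shows "1 \<le> degree G u"
proof -
  have "card {u} \<noteq> card (pverts G)" using assms(2) by simp
  then have "{u} \<noteq> pverts G" by metis
  then obtain v where "(u, v) \<in> parcs G"
    using connected_obtain_leaving_arc[OF assms(1), of "{u}"] assms(3) by blast
  then have "out_arcs (with_proj G) u \<noteq> {}" by force
  then show ?thesis unfolding out_degree_def
    using finite_out_arcs[of u] by (simp add: Suc_le_eq card_gt_0_iff)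
qed

lemma card_neighbours_le_degree:
  assumes "\<And>v. v \<in> B \<Longrightarrow> (u, v) \<in> parcs G"
  shows "card B \<le> degree G u"
proof -
  have "card B = card (Pair u ` B)" by (simp add: card_image inj_on_def)
  also have "\<dots> \<le> degree G u" unfolding out_degree_def
    by (rule card_mono) (use assms finite_out_arcs in auto)
  finally show ?thesis .
qed

text \<open>Two adjacent leaves would be cut off from the rest: an arc leaving \<open>{u, v}\<close>
  gives one of them a second neighbour.\<close>

lemma connected_not_adjacent_leaves:
  assumes "Digraph_Component.connected (with_proj G)" "card (pverts G) \<ge> 3" "(u, v) \<in> parcs G"
  shows "\<not> (degree G u = 1 \<and> degree G v = 1)"
proof
  assume deg: "degree G u = 1 \<and> degree G v = 1"
  have uv: "u \<noteq> v" "{u, v} \<subseteq> pverts G"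
    using assms(3) arc_neq in_arcsD1 in_arcsD2 by auto
  then have "card {u, v} \<noteq> card (pverts G)" using assms(2) by simp
  then have "{u, v} \<noteq> pverts G" by metis
  then obtain x y where xy: "x \<in> {u, v}" "y \<in> pverts G - {u, v}" "(x, y) \<in> parcs G"
    using connected_obtain_leaving_arc[OF assms(1), of "{u, v}"] uv by blast
  show False
  proof (cases "x = u")
    case True
    have "card {v, y} \<le> degree G u"
      by (rule card_neighbours_le_degree) (use True assms(3) xy in auto)
    moreover have "v \<noteq> y" using xy by auto
    ultimately show False using deg by simp
  next
    case False
    have "card {u, y} \<le> degree G v"
      by (rule card_neighbours_le_degree) (use False arc_rev[OF assms(3)] xy in auto)
    moreover have "u \<noteq> y" using xy by auto
    ultimately show False using deg by simp
  qed
qed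

text \<open>A vertex set is grown from a single vertex along leaving arcs; each new vertex adds an
  arc and its reverse.\<close>

lemma connected_card_parcs_ge:
  assumes "Digraph_Component.connected (with_proj G)"
  shows "2 * (card (pverts G) - 1) \<le> card (parcs G)"
proof -
  have "\<exists>S\<subseteq>pverts G. card S = Suc j \<and> 2 * j \<le> card (parcs G \<inter> S \<times> S)" if "Suc j \<le> card (pverts G)" for j
    using that
  proof (induction j)
    case 0
    then obtain a where "a \<in> pverts G" by fastforce
    then show ?case by (intro exI[of _ "{a}"]) auto
  next
    case (Suc j)
    then obtain S where S: "S \<subseteq> pverts G" "card S = Suc j" "2 * j \<le> card (parcs G \<inter> S \<times> S)"
      by auto
    obtain u v where uv: "u \<in> S" "v \<in> pverts G - S" "(u, v) \<in> parcs G"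
      by (rule connected_obtain_leaving_arc[OF assms S(1)]) (use S Suc.prems in auto)
    let ?T = "insert v S"
    have fS: "finite S" using S(1) pair_finite_verts finite_subset by blast
    have "card (insert (u, v) (insert (v, u) (parcs G \<inter> S \<times> S))) = card (parcs G \<inter> S \<times> S) + 2"
      using uv pair_finite_arcs arc_neq[OF uv(3)] by simp
    moreover have "card (insert (u, v) (insert (v, u) (parcs G \<inter> S \<times> S))) \<le> card (parcs G \<inter> ?T \<times> ?T)"
      by (rule card_mono) (use uv arc_rev pair_finite_arcs in auto)
    ultimately show ?case
      using S uv fS by (intro exI[of _ ?T]) auto
  qed
  note grow = this
  show ?thesis
  proof (cases "card (pverts G)")
    case (Suc j)
    then obtain S where "2 * j \<le> card (parcs G \<inter> S \<times> S)" using grow[of j] by auto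
    also have "\<dots> \<le> card (parcs G)"
      by (rule card_mono) (use pair_finite_arcs in auto)
    finally show ?thesis using Suc by simp
  qed simp
qed

text \<open>Extending a path from a vertex of degree at most one: an arc that leaves the vertices found so
  far can only start at the last one, as the others already have all their neighbours.\<close>

lemma connected_obtain_spanning_path:
  assumes conn: "Digraph_Component.connected (with_proj G)"
    and deg2: "\<And>u. u \<in> pverts G \<Longrightarrow> degree G u \<le> 2"
    and a: "a \<in> pverts G" "degree G a \<le> 1"
  obtains f :: "nat \<Rightarrow> 'a" where "bij_betw f {..<card (pverts G)} (pverts G)"
    "\<And>i. Suc i < card (pverts G) \<Longrightarrow> (f i, f (Suc i)) \<in> parcs G"
proof -
  \<comment> \<open>\<open>f 0 = a\<close> is kept in the invariant because the start has no
    predecessor: its own degree bound must exclude a second neighbour there.\<close>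
  let ?P = "\<lambda>j (f :: nat \<Rightarrow> 'a). f 0 = a \<and> inj_on f {..j} \<and> f ` {..j} \<subseteq> pverts G \<and> (\<forall>i<j. (f i, f (Suc i)) \<in> parcs G)"
  have ex: "\<exists>f. ?P j f" if "Suc j \<le> card (pverts G)" for j
    using that
  proof (induction j)
    case 0
    then show ?case using a by (intro exI[of _ "\<lambda>_. a"]) auto
  next
    case (Suc j)
    then obtain f where f0: "f 0 = a" and inj: "inj_on f {..j}" and sub: "f ` {..j} \<subseteq> pverts G"
      and step: "\<And>i. i < j \<Longrightarrow> (f i, f (Suc i)) \<in> parcs G"
      by auto
    have "card (f ` {..j}) = Suc j" using inj by (simp add: card_image)
    then have ne: "f ` {..j} \<noteq> pverts G" using Suc.prems by auto
    obtain x y where xy: "x \<in> f ` {..j}" "y \<in> pverts G - f ` {..j}" "(x, y) \<in> parcs G"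
      by (rule connected_obtain_leaving_arc[OF conn sub _ ne]) auto
    then obtain i where i: "i \<le> j" "x = f i" by auto
    have "i = j"
    proof (rule ccontr)
      assume "i \<noteq> j"
      then have ij: "i < j" using i by simp
      show False
      proof (cases i)
        case 0
        have "card {f (Suc i), y} \<le> degree G x"
          using step[OF ij] xy i by (intro card_neighbours_le_degree) auto
        moreover have "f (Suc i) \<noteq> y" using xy ij by auto
        ultimately show False using a f0 0 i by simp
      next
        case (Suc l)
        \<comment> \<open>An interior vertex would have three neighbours: predecessor, successor and
          \<open>y\<close>.\<close>
        have "card {f l, f (Suc i), y} \<le> degree G x"
          using step[OF ij] step[of l] arc_rev xy i ij Suc by (intro card_neighbours_le_degree) auto
        moreover have "f (Suc i) \<noteq> y" "f l \<noteq> y" using xy ij Suc by auto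
        moreover have "f l \<noteq> f (Suc i)" using inj ij Suc by (auto dest!: inj_onD)
        ultimately have "3 \<le> degree G x" by simp
        moreover have "degree G x \<le> 2" using xy sub deg2 by blast
        ultimately show False by simp
      qed
    qed
    let ?g = "f(Suc j := y)"
    have "inj_on ?g {..Suc j}"
      using inj xy(2) by (auto simp: inj_on_def atMost_Suc)
    moreover have "?g ` {..Suc j} \<subseteq> pverts G"
      using sub xy(2) by (auto simp: atMost_Suc)
    moreover have "\<forall>l<Suc j. (?g l, ?g (Suc l)) \<in> parcs G"
      using step xy(3) i(2) \<open>i = j\<close> by (auto simp: less_Suc_eq)
    moreover have "?g 0 = a" using f0 by simp
    ultimately show ?case by blast
  qed
  have pos: "card (pverts G) > 0" using a pair_finite_verts by (auto simp: card_gt_0_iff)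
  then obtain j where j: "card (pverts G) = Suc j" by (cases "card (pverts G)") auto
  then obtain f where f: "?P j f" using ex[of j] by auto
  have "card (f ` {..j}) = card (pverts G)" using f j by (simp add: card_image)
  then have "f ` {..j} = pverts G" using f pair_finite_verts by (simp add: card_subset_eq)
  then show ?thesis
    using f j by (intro that[of f]) (auto simp: bij_betw_def lessThan_Suc_atMost)
qed

end

section \<open>The path\<close>

lemma path_graph_simps:
  "pverts (path_graph n) = {..<n}"
  "parcs (path_graph n) = {(i, j). i < n \<and> j < n \<and> (j = Suc i \<or> i = Suc j)}"
  by (simp_all add: path_graph_def)

lemma finite_parcs_path_graph: "finite (parcs (path_graph n))"
  by (rule finite_subset[of _ "{..<n} \<times> {..<n}"]) (auto simp: path_graph_simps)

lemma pair_graph_path_graph: "pair_graph (path_graph n)"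
  by unfold_locales
    (auto simp: path_graph_simps finite_parcs_path_graph[unfolded path_graph_simps] symmetric_def sym_def)

lemma card_parcs_path_graph: "card (parcs (path_graph n)) = 2 * (n - 1)"
proof -
  let ?A = "(\<lambda>i. (i, Suc i)) ` {..<n - 1}" and ?B = "(\<lambda>i. (Suc i, i)) ` {..<n - 1}"
  have "parcs (path_graph n) = ?A \<union> ?B"
    by (auto simp: path_graph_simps)
  moreover have "card (?A \<union> ?B) = card ?A + card ?B"
    by (rule card_Un_disjoint) auto
  moreover have "card ?A = n - 1" "card ?B = n - 1"
    by (simp_all add: card_image inj_on_def)
  ultimately show ?thesis by simp
qed

lemma degree_path_graph_le: "degree (path_graph n) i \<le> 2"
proof -
  \<comment> \<open>At \<open>i = 0\<close> truncated subtraction makes the second pair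
    \<open>(0, 0)\<close>, which is not an arc; the inclusion still holds.\<close>
  have "out_arcs (with_proj (path_graph n)) i \<subseteq> {(i, Suc i), (i, i - 1)}"
    by (auto simp: out_arcs_def path_graph_simps)
  then have "degree (path_graph n) i \<le> card {(i, Suc i), (i, i - 1)}"
    unfolding out_degree_def by (intro card_mono) auto
  also have "\<dots> \<le> 2" by (simp add: card_insert_if)
  finally show ?thesis .
qed

text \<open>The arcs of the path inject into those of \<open>G\<close>, so equal cardinality makes the map onto.\<close>

lemma (in pair_graph) digraph_iso_path_graphI:
  assumes f: "bij_betw f {..<n} (pverts G)"
    and step: "\<And>i. Suc i < n \<Longrightarrow> (f i, f (Suc i)) \<in> parcs G"
    and card: "card (parcs G) = 2 * (n - 1)"
  shows "digraph_iso (with_proj G) (with_proj (path_graph n))"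
proof -
  interpret P: pair_graph "path_graph n" by (rule pair_graph_path_graph)
  let ?h = "\<lparr>iso_verts = f, iso_arcs = map_prod f f, iso_head = snd, iso_tail = fst\<rparr>"
  have inj: "inj_on f {..<n}" and img: "f ` {..<n} = pverts G"
    using f by (auto simp: bij_betw_def)
  have "inj_on (map_prod f f) ({..<n} \<times> {..<n})" by (rule map_prod_inj_on[OF inj inj])
  then have inja: "inj_on (map_prod f f) (parcs (path_graph n))"
    by (rule inj_on_subset) (auto simp: path_graph_simps)
  have "map_prod f f ` parcs (path_graph n) \<subseteq> parcs G"
    using step arc_rev by (auto simp: path_graph_simps)
  moreover have "card (map_prod f f ` parcs (path_graph n)) = card (parcs G)"
    using inja by (simp add: card_image card_parcs_path_graph card)
  ultimately have imga: "map_prod f f ` parcs (path_graph n) = parcs G"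
    using pair_finite_arcs by (simp add: card_subset_eq)
  have wf: "wf_digraph (with_proj (path_graph n))" by unfold_locales
  have "pre_digraph.digraph_isomorphism (with_proj (path_graph n)) ?h"
    unfolding pre_digraph.digraph_isomorphism_def
    using wf inj inja by (simp add: path_graph_simps(1))
  moreover have "with_proj G = app_iso ?h (with_proj (path_graph n))"
    by (simp add: app_iso_def with_proj_def[of G] img imga path_graph_simps(1))
  ultimately have "digraph_iso (with_proj (path_graph n)) (with_proj G)"
    unfolding digraph_iso_def by blast
  \<comment> \<open>The map was built from the path to \<open>G\<close>; the claim has the opposite
    direction.\<close>
  then show ?thesis by (rule digraph_iso_swap[OF wf])
qed

text \<open>An isomorphism is injective on arcs and preserves out-degrees, so both facts carry over
  from the path.\<close>

lemma (in pair_graph) digraph_iso_path_graphD: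
  assumes "digraph_iso (with_proj G) (with_proj (path_graph n))"
  shows "card (parcs G) = 2 * (n - 1)" "u \<in> pverts G \<Longrightarrow> degree G u \<le> 2"
proof -
  obtain h where h: "digraph_isomorphism h" "with_proj (path_graph n) = app_iso h (with_proj G)"
    using assms unfolding digraph_iso_def by blast
  have "parcs (path_graph n) = iso_arcs h ` parcs G"
    using arg_cong[OF h(2), of arcs] by simp
  then show "card (parcs G) = 2 * (n - 1)"
    using card_image[OF digraph_isomorphism_inj_on_arcs[OF h(1)]] card_parcs_path_graph[of n]
    by simp
  show "degree G u \<le> 2" if "u \<in> pverts G"
    using out_degree_app_iso_eq[OF h(1) that] degree_path_graph_le[of n "iso_verts h u"] h(2) by simp
qed

text \<open>Turns the equality conditions into an isomorphism. If every degree were at least two,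
  there would be at least \<open>2 * card (pverts G)\<close> arcs, too many; so a vertex of degree
  at most one exists, and the spanning path starts there.\<close>

lemma (in pair_graph) connected_iso_path_graph_iff:
  assumes "Digraph_Component.connected (with_proj G)" "card (pverts G) \<ge> 1"
  shows "digraph_iso (with_proj G) (with_proj (path_graph (card (pverts G)))) \<longleftrightarrow>
    card (parcs G) = 2 * (card (pverts G) - 1) \<and> (\<forall>u\<in>pverts G. degree G u \<le> 2)"
proof
  assume r: "card (parcs G) = 2 * (card (pverts G) - 1) \<and> (\<forall>u\<in>pverts G. degree G u \<le> 2)"
  have "\<exists>a\<in>pverts G. degree G a \<le> 1"
  proof (rule ccontr)
    assume "\<not> ?thesis"
    then have "(\<Sum>u\<in>pverts G. 2) \<le> (\<Sum>u\<in>pverts G. degree G u)"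
      by (intro sum_mono) force
    then show False using r assms(2) by (simp add: card_parcs_eq_sum_degree)
  qed
  then obtain a where a: "a \<in> pverts G" "degree G a \<le> 1" by blast
  show "digraph_iso (with_proj G) (with_proj (path_graph (card (pverts G))))"
    by (rule connected_obtain_spanning_path[OF assms(1) _ a])
      (use r in \<open>auto intro: digraph_iso_path_graphI\<close>)
qed (auto dest: digraph_iso_path_graphD)

text \<open>For \<open>n = 2\<close> the inequality fails: a single edge has index
  \<open>sqrt 2\<close>, below \<open>2 * sqrt 5 - 2 * sqrt 2\<close>. Hence
  \<open>n \<ge> 3\<close>.\<close>

theorem theorem2p8:
  fixes G :: "'a pair_pre_digraph" and n k :: nat
  assumes "pair_graph G"
    and "Digraph_Component.connected (with_proj G)"
    and "card (pverts G) = n"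
    and "n \<ge> 3"
    and "1 \<le> k" and "k \<le> n - 1"
    and "vertex_connectivity G \<le> k"
  shows "sombor_index G \<ge> 2 * sqrt 2 * (real n - 3) + 2 * sqrt 5 \<and>
    (sombor_index G = 2 * sqrt 2 * (real n - 3) + 2 * sqrt 5 \<longleftrightarrow>
       digraph_iso (with_proj G) (with_proj (path_graph n)))"
proof -
  interpret pair_graph G by fact
  let ?d = "degree G" and ?B = "2 * sqrt 2 * (real n - 3) + 2 * sqrt 5"
  let ?w = "\<lambda>(u, v). sqrt ((real (?d u))\<^sup>2 + (real (?d v))\<^sup>2)"
  let ?l = "\<lambda>(u, v). edge_bound (?d u) (?d v)"
  let ?c = "6 * sqrt 2 - 2 * sqrt 5"
  have pos: "1 \<le> ?d u" if "u \<in> pverts G" for u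
    using connected_degree_pos[OF assms(2) _ that] assms(3,4) by simp
  have nleaf: "\<not> (?d u = 1 \<and> ?d v = 1)" if "(u, v) \<in> parcs G" for u v
    using connected_not_adjacent_leaves[OF assms(2) _ that] assms(3,4) by simp
  have arc: "1 \<le> ?d u" "1 \<le> ?d v" if "(u, v) \<in> parcs G" for u v
    using that pos in_arcsD1 in_arcsD2 by blast+
  have w_ge: "?l e \<le> ?w e" if "e \<in> parcs G" for e
    using that arc nleaf by (cases e) (simp add: edge_bound_le)
  have w_eq_iff: "?w (u, v) = ?l (u, v) \<longleftrightarrow> ?d u \<le> 2 \<and> ?d v \<le> 2" if "(u, v) \<in> parcs G" for u v
    using edge_bound_less[of "?d u" "?d v"] edge_bound_eq[of "?d u" "?d v"] arc[OF that] nleaf[OF that]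
    by (cases "3 \<le> ?d u \<or> 3 \<le> ?d v") auto
  \<comment> \<open>Every vertex lies on an arc, so a degree condition on the ends of all arcs
    reaches all vertices.\<close>
  have nbr: "\<exists>v. (u, v) \<in> parcs G" if "u \<in> pverts G" for u
  proof -
    have "out_arcs (with_proj G) u \<noteq> {}" using pos[OF that] by (auto simp: out_degree_def)
    then show ?thesis by auto
  qed
  have sum_l: "sum ?l (parcs G) = 2 * ?B + ?c * (real (card (parcs G)) - 2 * (real n - 1))"
    using sum_edge_bound[OF pos] assms(3) by (simp add: algebra_simps)
  \<comment> \<open>Twice the gap splits into the slack of the edge bounds and a positive multiple
    of the number of arcs beyond those of a tree. Both are nonnegative, so equality means that both
    vanish.\<close>
  have excess: "2 * (sombor_index G - ?B) =
      (sum ?w (parcs G) - sum ?l (parcs G)) + ?c * (real (card (parcs G)) - 2 * (real n - 1))"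
    using sombor_index_parcs sum_l by simp
  have c_pos: "?c > 0" using sqrt2_sqrt5_bounds by linarith
  have "2 * (n - 1) \<le> card (parcs G)" using connected_card_parcs_ge[OF assms(2)] assms(3) by simp
  then have m: "2 * (real n - 1) \<le> real (card (parcs G))" using assms(4) of_nat_mono[of "2 * (n - 1)" "card (parcs G)", where 'a = real] by (simp add: of_nat_diff)
  have ge1: "sum ?w (parcs G) - sum ?l (parcs G) \<ge> 0" using sum_mono[of "parcs G" ?l ?w] w_ge by simp
  have ge2: "?c * (real (card (parcs G)) - 2 * (real n - 1)) \<ge> 0"
    using c_pos m by (intro mult_nonneg_nonneg) auto
  have "sum ?w (parcs G) = sum ?l (parcs G) \<longleftrightarrow> (\<forall>e\<in>parcs G. ?w e = ?l e)"
  proof -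
    have "(\<Sum>e\<in>parcs G. ?w e - ?l e) = 0 \<longleftrightarrow> (\<forall>e\<in>parcs G. ?w e - ?l e = 0)"
      by (rule sum_nonneg_eq_0_iff) (use pair_finite_arcs w_ge in \<open>simp_all only: diff_ge_0_iff_ge\<close>)
    then show ?thesis by (simp only: sum_subtractf right_minus_eq)
  qed
  also have "\<dots> \<longleftrightarrow> (\<forall>u\<in>pverts G. ?d u \<le> 2)"
    using w_eq_iff nbr in_arcsD1 in_arcsD2 by fast
  finally have eq1: "sum ?w (parcs G) = sum ?l (parcs G) \<longleftrightarrow> (\<forall>u\<in>pverts G. ?d u \<le> 2)" .
  have eq2: "?c * (real (card (parcs G)) - 2 * (real n - 1)) = 0 \<longleftrightarrow> card (parcs G) = 2 * (n - 1)"
  proof -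
    have "real (card (parcs G)) = 2 * (real n - 1) \<longleftrightarrow> card (parcs G) = 2 * (n - 1)"
      using assms(4) of_nat_eq_iff[of "card (parcs G)" "2 * (n - 1)", where 'a = real]
      by (simp add: of_nat_diff)
    then show ?thesis using c_pos by auto
  qed
  have "sombor_index G = ?B \<longleftrightarrow> 2 * (sombor_index G - ?B) = 0" by (simp only: mult_eq_0_iff right_minus_eq) simp
  also have "\<dots> \<longleftrightarrow> card (parcs G) = 2 * (n - 1) \<and> (\<forall>u\<in>pverts G. ?d u \<le> 2)"
    unfolding excess add_nonneg_eq_0_iff[OF ge1 ge2] right_minus_eq[of "sum ?w (parcs G)"] eq1 eq2
    by (rule conj_commute)
  finally have "sombor_index G = ?B \<longleftrightarrow> card (parcs G) = 2 * (n - 1) \<and> (\<forall>u\<in>pverts G. ?d u \<le> 2)" .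
  then show ?thesis
    using excess ge1 ge2 connected_iso_path_graph_iff[OF assms(2)] assms(3,4) by auto
qed

end
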